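(* Let $n \ge 1$ and $k \ge 1$ be integers and let $N = n + \frac12$. Then $$S_{2k-1} = \Omega_k \begin{vmatrix} \binom{2}{1} & 0 & 0 & \cdots & 0 & (2N)^2 -1 \\ \binom{4}{1} & \binom{4}{3} & 0 & \cdots & 0 & (2N)^4 -1 \\ \binom{6}{1} & \binom{6}{3} & \binom{6}{5} & \cdots & 0 & (2N)^6 -1 \\ \vdots & \vdots & \vdots & \ddots & \vdots & \vdots \\ \binom{2k-2}{1} & \binom{2k-2}{3} & \binom{2k-2}{5} & \cdots & \binom{2k-2}{2k-3} & (2N)^{2k-2}-1 \\ \binom{2k}{1} & \binom{2k}{3} & \binom{2k}{5} & \cdots & \binom{2k}{2k-3} & (2N)^{2k} - 1 \end{vmatrix}, \qquad \Omega_k = \frac{1}{k!\, 8^k}.$$ That is, the determinant is that of the $k\times k$ matrix whose $(i,j)$ entry is $\binom{2i}{2j-1}$ for $1 \le i \le k$, $1 \le j \le k-1$ (which is $0$ when $j>i$), and whose $(i,k)$ entry is $(2N)^{2i}-1$ for $1 \le i \le k$; for $k=1$ this reads $S_1 = \Omega_1[(2N)^2-1]$. In particular, for each $k \ge 1$ this gives $S_{2k-1}$ as an even polynomial in $N$ of degree $2k$ (with coefficients independent of $n$).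
   Context: For integers $m \ge 0$ and $n \ge 1$, $S_m = 1^m + 2^m + \cdots + n^m$ denotes the sum of the $m$th powers of the first $n$ positive integers (the dependence on $n$ is suppressed in the notation). *)

theory Defs
  imports "HOL-Computational_Algebra.Polynomial" "Jordan_Normal_Form.Determinant"
begin

definition power_sum :: "nat \<Rightarrow> nat \<Rightarrow> nat" where
  "power_sum m n = (\<Sum>i = 1..n. i ^ m)"

text \<open>Matrices are indexed from \<open>0\<close>, so position \<open>(i, j)\<close> is the entry in row \<open>i + 1\<close>
  and column \<open>j + 1\<close> of the usual 1-based numbering.\<close>

definition faulhaber_mat :: "nat \<Rightarrow> real \<Rightarrow> real mat" where
  "faulhaber_mat k x = mat k k (\<lambda>(i, j).
     if j + 1 < k then real (2 * (i + 1) choose (2 * (j + 1) - 1))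
     else (2 * x) ^ (2 * (i + 1)) - 1)"

definition Omega :: "nat \<Rightarrow> real" where
  "Omega k = 1 / (fact k * 8 ^ k)"

end

theory Submission imports Defs begin

text \<open>
  Put \<open>N = n + 1/2\<close>. Telescoping \<open>(2 r + 1) ^ (2 m) - (2 r - 1) ^ (2 m)\<close> over \<open>r = 1, \<dots>, n\<close> gives
  \<open>(2 N) ^ (2 m) - 1\<close>, while the binomial theorem turns each summand into a combination of odd
  powers of \<open>r\<close>. Hence, for \<open>m = 1, \<dots>, k\<close>, the unknowns \<open>4 ^ j * S\<^bsub>2 j - 1\<^esub>\<close> solve a lower
  triangular linear system with coefficients \<open>2 m choose (2 j - 1)\<close> and right-hand side
  \<open>(2 N) ^ (2 m) - 1\<close> (\<open>odd_power_sums_system\<close>). The diagonal is \<open>2, 4, \<dots>, 2 k\<close>, so the system has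
  determinant \<open>2 ^ k * fact k\<close>, and Cramer's rule for the last unknown is the claimed formula, with
  \<open>1 / (4 ^ k * 2 ^ k * fact k) = Omega k\<close>.

  For the polynomial, the variable occurs in the last column only. Laplace expansion along that
  column exhibits the determinant as a combination of the even polynomials \<open>(2 x) ^ (2 i) - 1\<close> with
  constant coefficients; the one of degree \<open>2 k\<close> occurs with the leading principal minor of order
  \<open>k - 1\<close>, which is triangular with nonzero diagonal.
\<close>

lemma sum_atMost_double_split:
  fixes f :: "nat \<Rightarrow> 'a :: comm_monoid_add"
  shows "(\<Sum>i\<le>2 * m. f i) = (\<Sum>j\<le>m. f (2 * j)) + (\<Sum>j<m. f (2 * j + 1))"
  by (induction m) (simp_all add: ac_simps)

lemma even_power_central_difference:
  fixes y :: "'a :: comm_ring_1"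
  shows "(y + 1) ^ (2 * m) - (y - 1) ^ (2 * m)
    = 2 * (\<Sum>j<m. of_nat (2 * m choose (2 * j + 1)) * y ^ (2 * j + 1))"
proof -
  let ?b = "\<lambda>i. of_nat (2 * m choose i) * y ^ i :: 'a"
  have plus: "(y + 1) ^ (2 * m) = (\<Sum>i\<le>2 * m. ?b i)"
    by (subst binomial_ring) simp
  have "(y - 1) ^ (2 * m) = (\<Sum>i\<le>2 * m. ?b i * (- 1) ^ (2 * m - i))"
    by (subst diff_conv_add_uminus, subst binomial_ring) simp
  also have "\<dots> = (\<Sum>i\<le>2 * m. ?b i * (- 1) ^ i)"
    by (intro sum.cong refl arg_cong2[where f = "(*)"]) (auto simp: minus_one_power_iff)
  finally have minus: "(y - 1) ^ (2 * m) = (\<Sum>i\<le>2 * m. ?b i * (- 1) ^ i)" .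
  show ?thesis
    unfolding plus minus sum_atMost_double_split
    by (simp add: sum_negf)
qed

text \<open>
  The right-hand side is a telescoping sum: passing from \<open>n\<close> to \<open>Suc n\<close> adds the central difference
  of \<open>y ^ (2 * m)\<close> at \<open>y = 2 * Suc n\<close>, whose factor \<open>2\<close> combines with \<open>2 ^ (2 * j + 1)\<close> to the weight
  \<open>4 ^ (j + 1)\<close>.
\<close>

lemma odd_power_sums_system:
  "(\<Sum>j<m. real (2 * m choose (2 * j + 1)) * (4 ^ (j + 1) * real (power_sum (2 * j + 1) n)))
    = (2 * (real n + 1 / 2)) ^ (2 * m) - 1"
proof (induction n)
  case 0
  then show ?case by (simp add: power_sum_def)
next
  case (Suc n)
  let ?c = "\<lambda>j. real (2 * m choose (2 * j + 1))"
  let ?y = "2 * real (Suc n)"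
  have "4 ^ (j + 1) * real (Suc n) ^ (2 * j + 1) = 2 * ?y ^ (2 * j + 1)" for j
    by (simp only: power_mult_distrib power_add power_mult) simp
  then have "(\<Sum>j<m. ?c j * (4 ^ (j + 1) * real (Suc n) ^ (2 * j + 1)))
      = (?y + 1) ^ (2 * m) - (?y - 1) ^ (2 * m)"
    unfolding even_power_central_difference sum_distrib_left
    by (intro sum.cong refl) (simp only: mult.left_commute)
  moreover have "(\<Sum>j<m. ?c j * (4 ^ (j + 1) * real (power_sum (2 * j + 1) (Suc n))))
      = (\<Sum>j<m. ?c j * (4 ^ (j + 1) * real (power_sum (2 * j + 1) n)))
        + (\<Sum>j<m. ?c j * (4 ^ (j + 1) * real (Suc n) ^ (2 * j + 1)))"
    unfolding sum.distrib[symmetric]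
    by (intro sum.cong refl) (simp add: power_sum_def algebra_simps)
  moreover have "?y - 1 = 2 * (real n + 1 / 2)" "?y + 1 = 2 * (real (Suc n) + 1 / 2)"
    by simp_all
  ultimately show ?case using Suc.IH by (simp add: ac_simps)
qed

definition odd_binomial_mat :: "nat \<Rightarrow> real mat" where
  "odd_binomial_mat k = mat k k (\<lambda>(i, j). real (2 * (i + 1) choose (2 * j + 1)))"

lemma odd_binomial_mat_carrier [simp]: "odd_binomial_mat k \<in> carrier_mat k k"
  by (simp add: odd_binomial_mat_def)

lemma det_odd_binomial_mat: "det (odd_binomial_mat k) = 2 ^ k * fact k"
proof -
  have "det (odd_binomial_mat k) = prod_list (diag_mat (odd_binomial_mat k))"
    by (rule det_lower_triangular[of k]) (auto simp: odd_binomial_mat_def binomial_eq_0)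
  also have "\<dots> = (\<Prod>i<k. real (2 * (i + 1) choose (2 * i + 1)))"
    by (simp add: prod_list_diag_prod odd_binomial_mat_def atLeast0LessThan binomial_eq_0)
  also have "\<dots> = (\<Prod>i<k. 2 * real (i + 1))"
  proof (intro prod.cong refl)
    fix i
    have "2 * (i + 1) choose (2 * i + 1) = 2 * (i + 1)"
      using binomial_symmetric[of 1 "2 * (i + 1)"] by simp
    then show "real (2 * (i + 1) choose (2 * i + 1)) = 2 * real (i + 1)" by simp
  qed
  also have "\<dots> = 2 ^ k * fact k"
    by (induction k) (simp_all add: algebra_simps)
  finally show ?thesis .
qed

lemma power_sum_eq_det:
  assumes "k \<ge> 1"
  shows "real (power_sum (2 * k - 1) n) = Omega k * det (faulhaber_mat k (real n + 1 / 2))"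
proof -
  define s where "s = vec k (\<lambda>j. 4 ^ (j + 1) * real (power_sum (2 * j + 1) n))"
  have entry: "(odd_binomial_mat k *\<^sub>v s) $ i = (2 * (real n + 1 / 2)) ^ (2 * (i + 1)) - 1"
    if "i < k" for i
  proof -
    have "(odd_binomial_mat k *\<^sub>v s) $ i = (\<Sum>j<k. real (2 * (i + 1) choose (2 * j + 1))
        * (4 ^ (j + 1) * real (power_sum (2 * j + 1) n)))"
      using that by (simp add: odd_binomial_mat_def s_def scalar_prod_def atLeast0LessThan)
    \<comment> \<open>Binomial coefficients above the diagonal vanish, so the row stops at column \<open>i\<close>.\<close>
    also have "\<dots> = (\<Sum>j<i + 1. real (2 * (i + 1) choose (2 * j + 1))
        * (4 ^ (j + 1) * real (power_sum (2 * j + 1) n)))"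
      using that by (intro sum.mono_neutral_right) (auto simp: binomial_eq_0)
    finally show ?thesis unfolding odd_power_sums_system .
  qed
  have "faulhaber_mat k (real n + 1 / 2)
      = replace_col (odd_binomial_mat k) (odd_binomial_mat k *\<^sub>v s) (k - 1)"
    by (rule eq_matI)
      (use entry in \<open>auto simp: faulhaber_mat_def replace_col_def odd_binomial_mat_def\<close>)
  then have "det (faulhaber_mat k (real n + 1 / 2)) = s $ (k - 1) * (2 ^ k * fact k)"
    using cramer_lemma_mat[of "odd_binomial_mat k" k s "k - 1"] assms
    by (simp add: s_def det_odd_binomial_mat)
  also have "s $ (k - 1) = 4 ^ k * real (power_sum (2 * k - 1) n)"
    using assms by (cases k) (simp_all add: s_def)
  also have "(4 :: real) ^ k * a * (2 ^ k * fact k) = a * (fact k * 8 ^ k)" for a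
    using power_mult_distrib[of "4 :: real" 2 k] by simp
  finally show ?thesis by (simp add: Omega_def)
qed

lemma mat_delete_last_col_faulhaber_mat:
  assumes "i < k"
  shows "mat_delete (faulhaber_mat k x) i (k - 1) = mat_delete (odd_binomial_mat k) i (k - 1)"
  using assms
  by (intro eq_matI) (auto simp: mat_delete_def faulhaber_mat_def odd_binomial_mat_def)

lemma det_faulhaber_mat_expansion:
  assumes "k \<ge> 1"
  shows "det (faulhaber_mat k x)
    = (\<Sum>i<k. ((2 * x) ^ (2 * (i + 1)) - 1) * cofactor (odd_binomial_mat k) i (k - 1))"
proof -
  have "faulhaber_mat k x \<in> carrier_mat k k"
    by (simp add: faulhaber_mat_def)
  from laplace_expansion_column[OF this, of "k - 1"] assms
  have "det (faulhaber_mat k x)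
      = (\<Sum>i<k. faulhaber_mat k x $$ (i, k - 1) * cofactor (faulhaber_mat k x) i (k - 1))"
    by simp
  also have "\<dots> = (\<Sum>i<k. ((2 * x) ^ (2 * (i + 1)) - 1) * cofactor (odd_binomial_mat k) i (k - 1))"
    unfolding cofactor_def
    by (intro sum.cong refl arg_cong2[where f = "(*)"] arg_cong[where f = det]
          mat_delete_last_col_faulhaber_mat) (auto simp: faulhaber_mat_def)
  finally show ?thesis .
qed

lemma last_cofactor_odd_binomial_mat:
  assumes "k \<ge> 1"
  shows "cofactor (odd_binomial_mat k) (k - 1) (k - 1) = 2 ^ (k - 1) * fact (k - 1)"
proof -
  have "mat_delete (odd_binomial_mat k) (k - 1) (k - 1) = odd_binomial_mat (k - 1)"
    using assms by (intro eq_matI) (auto simp: mat_delete_def odd_binomial_mat_def)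
  then show ?thesis by (simp add: cofactor_def det_odd_binomial_mat)
qed

definition faulhaber_poly :: "nat \<Rightarrow> real poly" where
  "faulhaber_poly k = (\<Sum>i<k. smult (Omega k * cofactor (odd_binomial_mat k) i (k - 1))
     (monom (2 ^ (2 * (i + 1))) (2 * (i + 1)) - 1))"

lemma poly_faulhaber_poly:
  assumes "k \<ge> 1"
  shows "poly (faulhaber_poly k) x = Omega k * det (faulhaber_mat k x)"
  unfolding faulhaber_poly_def poly_sum det_faulhaber_mat_expansion[OF assms] sum_distrib_left
  by (intro sum.cong refl) (simp add: poly_monom power_mult_distrib mult_ac del: power_Suc)

lemma poly_faulhaber_poly_even: "poly (faulhaber_poly k) (- x) = poly (faulhaber_poly k) x"
  by (simp add: faulhaber_poly_def poly_sum poly_monom del: power_Suc mult_Suc_right)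

lemma degree_faulhaber_poly:
  assumes "k \<ge> 1"
  shows "degree (faulhaber_poly k) = 2 * k"
proof (rule antisym)
  show "degree (faulhaber_poly k) \<le> 2 * k"
    unfolding faulhaber_poly_def
    by (intro degree_sum_le order.trans[OF degree_smult_le] degree_diff_le
          order.trans[OF degree_monom_le]) auto
  have "coeff (faulhaber_poly k) (2 * k)
      = (\<Sum>i<k. if i = k - 1
          then Omega k * cofactor (odd_binomial_mat k) i (k - 1) * 2 ^ (2 * k) else 0)"
    unfolding faulhaber_poly_def coeff_sum
    using assms by (intro sum.cong refl) (cases k; auto)
  also have "\<dots> = Omega k * (2 ^ (k - 1) * fact (k - 1)) * 2 ^ (2 * k)"
    using assms unfolding last_cofactor_odd_binomial_mat[OF assms, symmetric] by simp
  also have "\<dots> \<noteq> 0" by (simp add: Omega_def)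
  finally show "2 * k \<le> degree (faulhaber_poly k)" by (rule le_degree)
qed

theorem mainTheorem3:
  fixes k :: nat
  assumes "k \<ge> 1"
  shows "(\<forall>n\<ge>1. real (power_sum (2 * k - 1) n)
            = Omega k * det (faulhaber_mat k (real n + 1 / 2)))
       \<and> (\<exists>p :: real poly.
            degree p = 2 * k
          \<and> (\<forall>x. poly p (- x) = poly p x)
          \<and> (\<forall>x. poly p x = Omega k * det (faulhaber_mat k x))
          \<and> (\<forall>n\<ge>1. real (power_sum (2 * k - 1) n) = poly p (real n + 1 / 2)))"
  using power_sum_eq_det[OF assms] poly_faulhaber_poly[OF assms] poly_faulhaber_poly_even
    degree_faulhaber_poly[OF assms]
  by (intro conjI exI[of _ "faulhaber_poly k"]) auto

end
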